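(* Let $\mathcal{A}=(\mathfrak{so}(2),\nabla)$ be $\mathfrak{so}(2)$ with the product $X\cdot Y=\nabla_XY=\frac12[X,Y]$. Let $\mathrm{H}^k=\mathrm{H}^k(\mathfrak{so}(2),\mathbb{R})$ and $\mathrm{H}^k_{KV}=\mathrm{H}^k_{KV}(\mathcal{A},\mathfrak{so}(2))$ be the $k$-th cohomology groups of the de Rham cohomology and of the KV-cohomology on $\mathfrak{so}(2)$. Given the isomorphism $\Psi^k:\mathrm{H}^k\to\mathrm{H}^k_{KV}$ ($k=0,1$), the quotients $\mathrm{Q}^k=\mathrm{H}^k_{KV}/\mathrm{Im}\,\Psi^k$ satisfy $$\mathrm{Q}^0=0,\qquad \mathrm{Q}^1=0.$$
   Context: $\mathrm{H}^k(\mathfrak{so}(2),\mathbb{R})$ is the cohomology of left-invariant forms on $\mathrm{SO}(2)$ with the exterior differential. The map $\Psi^k$ is the morphism which the paper describes as induced by the inclusion of differential forms in the KV-complex, and it is given as an isomorphism; $\mathrm{Q}^k=\mathrm{coker}\,\Psi^k$. KV-cohomology: for an algebra, $(a,b,c)=(ab)c-a(bc)$; a KV-algebra satisfies $(a,b,c)=(b,a,c)$. For a KV-module $W$ over a KV-algebra $\mathcal{A}$ (left and right actions with $(a,b,w)=(b,a,w)$ and $(a,w,b)=(w,a,b)$), $J(W)=\{w:(a,b,w)=0\ \forall a,b\}$, $C^q(\mathcal{A},W)=0$ for $q<0$, $C^0(\mathcal{A},W)=J(W)$ and $C^q(\mathcal{A},W)=\mathrm{Hom}_{\mathbb{R}}(\otimes^q\mathcal{A},W)$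 for $q\ge1$. The coboundary is $\delta^0_{KV}f(a)=-af+fa$ and, for $q\ge1$, $$\delta^q_{KV}f(a_1,\dots,a_{q+1})=\sum_{j=1}^q(-1)^j\Big((a_jf)(a_1,\dots,\hat a_j,\dots,a_{q+1})+\big(f(a_1,\dots,\hat a_j,\dots,a_q,a_j)\big)\cdot a_{q+1}\Big),$$ where $(af)(b_1,\dots,b_q)=a\cdot f(b_1,\dots,b_q)-\sum_i f(b_1,\dots,ab_i,\dots,b_q)$. Then $\mathrm{H}^q_{KV}(\mathcal{A},W)=\ker\delta^q_{KV}/\mathrm{Im}\,\delta^{q-1}_{KV}$. Here $W=\mathfrak{so}(2)$ with the adjoint module structure. *)

theory Defs
  imports "HOL-Analysis.Analysis" "HOL-Algebra.Elementary_Groups"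
begin

section \<open>The Lie algebra of skew-symmetric real 2 x 2 matrices\<close>

typedef so2 = "{X :: real^2^2. transpose X = - X}"
  by (rule exI[of _ 0]) (simp add: transpose_def vec_eq_iff)

setup_lifting type_definition_so2

lemma transpose_add: "transpose (A + B) = transpose A + transpose B"
  and transpose_diff: "transpose (A - B) = transpose A - transpose B"
  and transpose_uminus: "transpose (- A) = - transpose A"
  for A B :: "real^'n^'m"
  by (simp_all add: transpose_def vec_eq_iff)

instantiation so2 :: real_vector
begin

lift_definition zero_so2 :: so2 is 0
  by (simp add: transpose_def vec_eq_iff)

lift_definition plus_so2 :: "so2 \<Rightarrow> so2 \<Rightarrow> so2" is "(+)"
  by (simp add: transpose_add)

lift_definition minus_so2 :: "so2 \<Rightarrow> so2 \<Rightarrow> so2" is "(-)"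
  by (simp add: transpose_diff)

lift_definition uminus_so2 :: "so2 \<Rightarrow> so2" is uminus
  by (simp add: transpose_uminus)

lift_definition scaleR_so2 :: "real \<Rightarrow> so2 \<Rightarrow> so2" is scaleR
  by (simp add: transpose_scalar)

instance
  by standard (transfer; simp add: algebra_simps)+

end

lift_definition so2_bracket :: "so2 \<Rightarrow> so2 \<Rightarrow> so2" is "\<lambda>X Y. X ** Y - Y ** X"
proof -
  fix X Y :: "real^2^2"
  assume "transpose X = - X" "transpose Y = - Y"
  then have "transpose (X ** Y) = Y ** X" "transpose (Y ** X) = X ** Y"
    by (simp_all add: matrix_transpose_mul) (simp_all add: matrix_matrix_mult_def vec_eq_iff)
  then show "transpose (X ** Y - Y ** X) = - (X ** Y - Y ** X)" by (simp add: transpose_diff)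
qed

definition so2_mult :: "so2 \<Rightarrow> so2 \<Rightarrow> so2" where
  "so2_mult X Y = (1/2) *\<^sub>R so2_bracket X Y"


section \<open>Cochains and quotients\<close>

text \<open>A cochain of degree \<open>q\<close> is a multilinear function of the argument list
  \<open>[a\<^sub>1, \<dots>, a\<^sub>q]\<close>, normalised to \<open>0\<close> on lists of any other length. A cochain of
  degree \<open>0\<close> is thus the same as its value at \<open>[]\<close>.\<close>

definition multilinear_of_degree :: "nat \<Rightarrow> ('a::real_vector list \<Rightarrow> 'w::real_vector) \<Rightarrow> bool" where
  "multilinear_of_degree q f \<longleftrightarrow>
     (\<forall>xs. length xs \<noteq> q \<longrightarrow> f xs = 0) \<and>
     (\<forall>xs i. length xs = q \<longrightarrow> i < q \<longrightarrow> linear (\<lambda>x. f (xs[i := x])))"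

definition omit :: "nat \<Rightarrow> 'a list \<Rightarrow> 'a list" where
  "omit i xs = take i xs @ drop (Suc i) xs"

definition fun_group :: "('b \<Rightarrow> 'w::real_vector) set \<Rightarrow> ('b \<Rightarrow> 'w) monoid" where
  "fun_group Z = \<lparr>carrier = Z, mult = (\<lambda>f g x. f x + g x), one = (\<lambda>x. 0)\<rparr>"

text \<open>Scalar multiplication on cosets of \<open>B\<close>; adding \<open>B\<close> makes \<open>c = 0\<close> yield the
  whole zero class.\<close>

definition coset_scale ::
  "('b \<Rightarrow> 'w::real_vector) set \<Rightarrow> real \<Rightarrow> ('b \<Rightarrow> 'w) set \<Rightarrow> ('b \<Rightarrow> 'w) set" where
  "coset_scale B c K = {(\<lambda>x. c *\<^sub>R f x + b x) | f b. f \<in> K \<and> b \<in> B}"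


section \<open>Left-invariant forms\<close>

text \<open>A left-invariant form on a Lie group is determined by its value at the identity, an
  alternating form on the Lie algebra. Evaluated on left-invariant vector fields, the
  derivative terms of the invariant formula for the exterior differential vanish, which
  leaves the bracket terms below.\<close>

definition lie_forms :: "nat \<Rightarrow> ('g::real_vector list \<Rightarrow> real) set" where
  "lie_forms k = {\<omega>. multilinear_of_degree k \<omega> \<and>
     (\<forall>xs i j. length xs = k \<longrightarrow> i < j \<longrightarrow> j < k \<longrightarrow> xs ! i = xs ! j \<longrightarrow> \<omega> xs = 0)}"

definition lie_d ::
  "('g::real_vector \<Rightarrow> 'g \<Rightarrow> 'g) \<Rightarrow> nat \<Rightarrow> ('g list \<Rightarrow> real) \<Rightarrow> 'g list \<Rightarrow> real" where
  "lie_d br k \<omega> xs =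
     (if length xs = Suc k
      then \<Sum>j\<le>k. \<Sum>i<j. (-1) ^ (i + j) * \<omega> (br (xs ! i) (xs ! j) # omit i (omit j xs))
      else 0)"

definition lie_cocycles :: "('g::real_vector \<Rightarrow> 'g \<Rightarrow> 'g) \<Rightarrow> nat \<Rightarrow> ('g list \<Rightarrow> real) set" where
  "lie_cocycles br k = {\<omega> \<in> lie_forms k. lie_d br k \<omega> = (\<lambda>xs. 0)}"

fun lie_coboundaries :: "('g::real_vector \<Rightarrow> 'g \<Rightarrow> 'g) \<Rightarrow> nat \<Rightarrow> ('g list \<Rightarrow> real) set" where
  "lie_coboundaries br 0 = {\<lambda>xs. 0}"
| "lie_coboundaries br (Suc k) = lie_d br k ` lie_forms k"

definition lie_cohomology ::
  "('g::real_vector \<Rightarrow> 'g \<Rightarrow> 'g) \<Rightarrow> nat \<Rightarrow> ('g list \<Rightarrow> real) set monoid" where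
  "lie_cohomology br k = fun_group (lie_cocycles br k) Mod lie_coboundaries br k"


section \<open>KV-cohomology\<close>

definition kv_algebra :: "('a::real_vector \<Rightarrow> 'a \<Rightarrow> 'a) \<Rightarrow> bool" where
  "kv_algebra m \<longleftrightarrow> bilinear m \<and>
     (\<forall>a b c. m (m a b) c - m a (m b c) = m (m b a) c - m b (m a c))"

definition kv_module ::
  "('a::real_vector \<Rightarrow> 'a \<Rightarrow> 'a) \<Rightarrow> ('a \<Rightarrow> 'w::real_vector \<Rightarrow> 'w) \<Rightarrow> ('w \<Rightarrow> 'a \<Rightarrow> 'w) \<Rightarrow> bool" where
  "kv_module m l r \<longleftrightarrow> bilinear l \<and> bilinear r \<and>
     (\<forall>a b w. l (m a b) w - l a (l b w) = l (m b a) w - l b (l a w)) \<and>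
     (\<forall>a b w. r (l a w) b - l a (r w b) = r (r w a) b - r w (m a b))"

definition kv_J ::
  "('a::real_vector \<Rightarrow> 'a \<Rightarrow> 'a) \<Rightarrow> ('a \<Rightarrow> 'w::real_vector \<Rightarrow> 'w) \<Rightarrow> 'w set" where
  "kv_J m l = {w. \<forall>a b. l (m a b) w - l a (l b w) = 0}"

definition kv_cochains ::
  "('a::real_vector \<Rightarrow> 'a \<Rightarrow> 'a) \<Rightarrow> ('a \<Rightarrow> 'w::real_vector \<Rightarrow> 'w) \<Rightarrow> nat \<Rightarrow> ('a list \<Rightarrow> 'w) set" where
  "kv_cochains m l q = {f. multilinear_of_degree q f \<and> (q = 0 \<longrightarrow> f [] \<in> kv_J m l)}"

definition kv_act ::
  "('a::real_vector \<Rightarrow> 'a \<Rightarrow> 'a) \<Rightarrow> ('a \<Rightarrow> 'w::real_vector \<Rightarrow> 'w) \<Rightarrow> 'a \<Rightarrow> ('a list \<Rightarrow> 'w) \<Rightarrow> 'a list \<Rightarrow> 'w" where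
  "kv_act m l a f bs = l a (f bs) - (\<Sum>i<length bs. f (bs[i := m a (bs ! i)]))"

text \<open>The arguments \<open>a\<^sub>1, \<dots>, a\<^sub>q\<^sub>+\<^sub>1\<close> are \<open>xs ! 0, \<dots>, xs ! q\<close>, so \<open>a\<^sub>j\<close> is
  \<open>xs ! i\<close> with \<open>i = j - 1\<close> and the sign \<open>(-1)\<^sup>j\<close> becomes \<open>(-1) ^ Suc i\<close>.\<close>

definition kv_delta ::
  "('a::real_vector \<Rightarrow> 'a \<Rightarrow> 'a) \<Rightarrow> ('a \<Rightarrow> 'w::real_vector \<Rightarrow> 'w) \<Rightarrow> ('w \<Rightarrow> 'a \<Rightarrow> 'w) \<Rightarrow>
    nat \<Rightarrow> ('a list \<Rightarrow> 'w) \<Rightarrow> 'a list \<Rightarrow> 'w" where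
  "kv_delta m l r q f xs =
     (if length xs \<noteq> Suc q then 0
      else if q = 0 then - l (xs ! 0) (f []) + r (f []) (xs ! 0)
      else \<Sum>i<q. (-1) ^ Suc i *\<^sub>R
             (kv_act m l (xs ! i) f (omit i xs) +
              r (f (omit i (take q xs) @ [xs ! i])) (xs ! q)))"

definition kv_cocycles ::
  "('a::real_vector \<Rightarrow> 'a \<Rightarrow> 'a) \<Rightarrow> ('a \<Rightarrow> 'w::real_vector \<Rightarrow> 'w) \<Rightarrow> ('w \<Rightarrow> 'a \<Rightarrow> 'w) \<Rightarrow>
    nat \<Rightarrow> ('a list \<Rightarrow> 'w) set" where
  "kv_cocycles m l r q = {f \<in> kv_cochains m l q. kv_delta m l r q f = (\<lambda>xs. 0)}"

fun kv_coboundaries ::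
  "('a::real_vector \<Rightarrow> 'a \<Rightarrow> 'a) \<Rightarrow> ('a \<Rightarrow> 'w::real_vector \<Rightarrow> 'w) \<Rightarrow> ('w \<Rightarrow> 'a \<Rightarrow> 'w) \<Rightarrow>
    nat \<Rightarrow> ('a list \<Rightarrow> 'w) set" where
  "kv_coboundaries m l r 0 = {\<lambda>xs. 0}"
| "kv_coboundaries m l r (Suc q) = kv_delta m l r q ` kv_cochains m l q"

definition kv_cohomology ::
  "('a::real_vector \<Rightarrow> 'a \<Rightarrow> 'a) \<Rightarrow> ('a \<Rightarrow> 'w::real_vector \<Rightarrow> 'w) \<Rightarrow> ('w \<Rightarrow> 'a \<Rightarrow> 'w) \<Rightarrow>
    nat \<Rightarrow> ('a list \<Rightarrow> 'w) set monoid" where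
  "kv_cohomology m l r q = fun_group (kv_cocycles m l r q) Mod kv_coboundaries m l r q"


section \<open>The comparison map on \<open>so2\<close>\<close>

abbreviation so2_H :: "nat \<Rightarrow> (so2 list \<Rightarrow> real) set monoid" where
  "so2_H \<equiv> lie_cohomology so2_bracket"

abbreviation so2_HKV :: "nat \<Rightarrow> (so2 list \<Rightarrow> so2) set monoid" where
  "so2_HKV \<equiv> kv_cohomology so2_mult so2_mult so2_mult"

text \<open>Forms are real-valued and cochains are \<open>so2\<close>-valued, so the inclusion needs an
  injective linear map \<open>\<iota>\<close> of the coefficients; it sends \<open>\<omega>\<close> to \<open>\<iota> \<circ> \<omega>\<close>.
  \<open>so2_Psi\<close> is the induced map on classes. The union below is the single class of \<open>\<iota> \<circ> \<omega>\<close>,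
  since that class does not depend on the representative \<open>\<omega> \<in> K\<close>.\<close>

definition so2_Psi ::
  "(real \<Rightarrow> so2) \<Rightarrow> nat \<Rightarrow> (so2 list \<Rightarrow> real) set \<Rightarrow> (so2 list \<Rightarrow> so2) set" where
  "so2_Psi \<iota> k K = (\<Union>\<omega>\<in>K.
     kv_coboundaries so2_mult so2_mult so2_mult k
       #>\<^bsub>fun_group (kv_cocycles so2_mult so2_mult so2_mult k)\<^esub> (\<iota> \<circ> \<omega>))"

definition so2_linear_iso ::
  "nat \<Rightarrow> ((so2 list \<Rightarrow> real) set \<Rightarrow> (so2 list \<Rightarrow> so2) set) \<Rightarrow> bool" where
  "so2_linear_iso k \<Psi> \<longleftrightarrow> \<Psi> \<in> iso (so2_H k) (so2_HKV k) \<and>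
     (\<forall>c. \<forall>K \<in> carrier (so2_H k).
        \<Psi> (coset_scale (lie_coboundaries so2_bracket k) c K) =
        coset_scale (kv_coboundaries so2_mult so2_mult so2_mult k) c (\<Psi> K))"

definition so2_Q :: "(real \<Rightarrow> so2) \<Rightarrow> nat \<Rightarrow> (so2 list \<Rightarrow> so2) set set monoid" where
  "so2_Q \<iota> k = so2_HKV k Mod (so2_Psi \<iota> k ` carrier (so2_H k))"


section \<open>Basic facts\<close>

lemma skew_entries:
  fixes X :: "real^2^2"
  assumes "transpose X = - X"
  shows "X $ 1 $ 1 = 0" "X $ 2 $ 2 = 0" "X $ 2 $ 1 = - X $ 1 $ 2"
proof -
  have *: "X $ j $ i = - X $ i $ j" for i j
    using arg_cong[OF assms, of "\<lambda>A. A $ i $ j"] by (simp add: transpose_def)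
  show "X $ 1 $ 1 = 0" "X $ 2 $ 2 = 0" "X $ 2 $ 1 = - X $ 1 $ 2"
    using *[of 1 1] *[of 2 2] *[of 2 1] by linarith+
qed

lemma so2_bracket_eq_0: "so2_bracket X Y = 0"
proof (transfer, goal_cases)
  case (1 X Y)
  show ?case
    using skew_entries[OF 1(1)] skew_entries[OF 1(2)]
    by (simp add: vec_eq_iff matrix_matrix_mult_def sum_2 forall_2)
qed

lemma so2_mult_eq_0: "so2_mult X Y = 0"
  by (simp add: so2_mult_def so2_bracket_eq_0)

lemma kv_algebra_so2: "kv_algebra so2_mult"
  by (simp add: kv_algebra_def so2_mult_eq_0 bilinear_def linear_iff)

lemma kv_module_so2: "kv_module so2_mult so2_mult so2_mult"
  by (simp add: kv_module_def so2_mult_eq_0 bilinear_def linear_iff)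

lemma multilinear_of_degree_zero_arg:
  assumes "multilinear_of_degree q f" and "0 \<in> set xs"
  shows "f xs = 0"
proof (cases "length xs = q")
  case True
  from assms(2) obtain i where i: "i < length xs" "xs ! i = 0"
    by (auto simp: in_set_conv_nth)
  then have "linear (\<lambda>x. f (xs[i := x]))"
    using assms(1) True by (simp add: multilinear_of_degree_def)
  from linear_0[OF this] show ?thesis
    using i by (metis list_update_id)
qed (use assms(1) in \<open>auto simp: multilinear_of_degree_def\<close>)

lemma lie_d_so2:
  assumes "\<omega> \<in> lie_forms k"
  shows "lie_d so2_bracket k \<omega> = (\<lambda>xs. 0)"
proof -
  have "\<omega> (0 # ys) = 0" for ys
    using assms multilinear_of_degree_zero_arg[of k \<omega> "0 # ys"] by (simp add: lie_forms_def)
  then show ?thesis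
    by (simp add: fun_eq_iff lie_d_def so2_bracket_eq_0)
qed

lemma kv_delta_so2:
  assumes "f \<in> kv_cochains so2_mult so2_mult q"
  shows "kv_delta so2_mult so2_mult so2_mult q f = (\<lambda>xs. 0)"
proof -
  have "f (ys[i := 0]) = 0" if "i < length ys" for ys i
    using assms multilinear_of_degree_zero_arg[of q f "ys[i := 0]"] that
    by (simp add: kv_cochains_def set_update_memI)
  then show ?thesis
    by (simp add: fun_eq_iff kv_delta_def kv_act_def so2_mult_eq_0)
qed

lemma zero_in_lie_forms: "(\<lambda>xs. 0) \<in> lie_forms k"
  by (simp add: lie_forms_def multilinear_of_degree_def linear_iff)

lemma zero_in_kv_cochains_so2: "(\<lambda>xs. 0) \<in> kv_cochains so2_mult so2_mult q"
  by (simp add: kv_cochains_def multilinear_of_degree_def linear_iff kv_J_def so2_mult_eq_0)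

lemma lie_cocycles_so2: "lie_cocycles so2_bracket k = lie_forms k"
  using lie_d_so2 by (auto simp: lie_cocycles_def)

lemma kv_cocycles_so2:
  "kv_cocycles so2_mult so2_mult so2_mult q = kv_cochains so2_mult so2_mult q"
  using kv_delta_so2 by (auto simp: kv_cocycles_def)

lemma lie_coboundaries_so2: "lie_coboundaries so2_bracket k = {\<lambda>xs. 0}"
proof (cases k)
  case (Suc n)
  then show ?thesis using lie_d_so2[of _ n] zero_in_lie_forms[of n] by auto
qed simp

lemma kv_coboundaries_so2: "kv_coboundaries so2_mult so2_mult so2_mult q = {\<lambda>xs. 0}"
proof (cases q)
  case (Suc n)
  then show ?thesis using kv_delta_so2[of _ n] zero_in_kv_cochains_so2[of n] by auto
qed simp

lemma bij_linear_so2: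
  fixes \<iota> :: "real \<Rightarrow> so2"
  assumes "linear \<iota>" "inj \<iota>"
  shows "bij \<iota>"
proof -
  have "\<exists>t. X = t *\<^sub>R J" if "J \<noteq> 0" for X J :: so2
    using that
  proof (transfer, goal_cases)
    case (1 J X)
    note * = skew_entries[OF 1(1)] skew_entries[OF 1(3)]
    then have "J $ 1 $ 2 \<noteq> 0"
      using 1(2) by (auto simp: vec_eq_iff forall_2)
    then show ?case
      using * by (intro exI[of _ "X $ 1 $ 2 / J $ 1 $ 2"]) (simp add: vec_eq_iff forall_2)
  qed
  moreover have "\<iota> 1 \<noteq> 0"
    using assms by (metis injD linear_0 zero_neq_one)
  moreover have "\<iota> t = t *\<^sub>R \<iota> 1" for t
    using linear_scale[OF assms(1), of t 1] by simp
  ultimately have "\<exists>t. X = \<iota> t" for X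
    by metis
  then show ?thesis
    using assms(2) by (auto simp: bij_def surj_def)
qed

lemma multilinear_of_degree_comp:
  assumes "linear h" "multilinear_of_degree q f"
  shows "multilinear_of_degree q (h \<circ> f)"
  using assms linear_0[OF assms(1)]
  by (auto simp: multilinear_of_degree_def linear_iff)

lemma carrier_so2_H: "carrier (so2_H k) = (\<lambda>\<omega>. {\<omega>}) ` lie_forms k"
  by (auto simp: lie_cohomology_def FactGroup_def RCOSETS_def r_coset_def fun_group_def
      lie_cocycles_so2 lie_coboundaries_so2)

lemma carrier_so2_HKV: "carrier (so2_HKV k) = (\<lambda>f. {f}) ` kv_cochains so2_mult so2_mult k"
  by (auto simp: kv_cohomology_def FactGroup_def RCOSETS_def r_coset_def fun_group_def
      kv_cocycles_so2 kv_coboundaries_so2)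

lemma mult_so2_H: "{\<omega>} \<otimes>\<^bsub>so2_H k\<^esub> {\<eta>} = {\<lambda>xs. \<omega> xs + \<eta> xs}"
  by (simp add: lie_cohomology_def FactGroup_def set_mult_def fun_group_def)

lemma mult_so2_HKV: "{f} \<otimes>\<^bsub>so2_HKV k\<^esub> {g} = {\<lambda>xs. f xs + g xs}"
  by (simp add: kv_cohomology_def FactGroup_def set_mult_def fun_group_def)

lemma coset_scale_singleton: "coset_scale {\<lambda>x. 0} c {f} = {\<lambda>x. c *\<^sub>R f x}"
  by (auto simp: coset_scale_def)

lemma so2_Psi_singleton: "so2_Psi \<iota> k {\<omega>} = {\<iota> \<circ> \<omega>}"
  by (simp add: so2_Psi_def r_coset_def fun_group_def kv_coboundaries_so2 comp_def)

lemma so2_linear_iso_Psi: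
  assumes "linear \<iota>" "inj \<iota>" "k \<le> 1"
  shows "so2_linear_iso k (so2_Psi \<iota> k)"
proof -
  have bij: "bij \<iota>" by (rule bij_linear_so2[OF assms(1,2)])
  then have right_inv: "\<iota> (inv_into UNIV \<iota> y) = y" for y
    by (simp add: bij_is_surj surj_f_inv_f)
  have inv: "linear (inv_into UNIV \<iota>)"
  proof (rule linearI)
    show "inv_into UNIV \<iota> (x + y) = inv_into UNIV \<iota> x + inv_into UNIV \<iota> y" for x y
      by (rule injD[OF assms(2)]) (simp add: right_inv linear_add[OF assms(1)])
    show "inv_into UNIV \<iota> (c *\<^sub>R x) = c *\<^sub>R inv_into UNIV \<iota> x" for c x
      by (rule injD[OF assms(2)]) (simp only: right_inv linear_scale[OF assms(1)])
  qed
  have img: "(\<lambda>\<omega>. \<iota> \<circ> \<omega>) ` lie_forms k = kv_cochains so2_mult so2_mult k"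
  proof
    show "(\<lambda>\<omega>. \<iota> \<circ> \<omega>) ` lie_forms k \<subseteq> kv_cochains so2_mult so2_mult k"
      using multilinear_of_degree_comp[OF assms(1)]
      by (auto simp: lie_forms_def kv_cochains_def kv_J_def so2_mult_eq_0)
    show "kv_cochains so2_mult so2_mult k \<subseteq> (\<lambda>\<omega>. \<iota> \<circ> \<omega>) ` lie_forms k"
    proof
      fix f assume "f \<in> kv_cochains so2_mult so2_mult k"
      then have "inv_into UNIV \<iota> \<circ> f \<in> lie_forms k"
        using multilinear_of_degree_comp[OF inv] assms(3)
        by (auto simp: lie_forms_def kv_cochains_def)
      moreover have "f = \<iota> \<circ> (inv_into UNIV \<iota> \<circ> f)"
        by (simp add: fun_eq_iff right_inv)
      ultimately show "f \<in> (\<lambda>\<omega>. \<iota> \<circ> \<omega>) ` lie_forms k" by blast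
    qed
  qed
  have "inj_on (so2_Psi \<iota> k) (carrier (so2_H k))"
    using assms(2) by (auto simp: carrier_so2_H so2_Psi_singleton inj_on_def fun_eq_iff)
  moreover have surj: "so2_Psi \<iota> k ` carrier (so2_H k) = carrier (so2_HKV k)"
    by (simp add: carrier_so2_H carrier_so2_HKV image_image so2_Psi_singleton flip: img)
  moreover have "so2_Psi \<iota> k \<in> hom (so2_H k) (so2_HKV k)"
  proof (rule homI)
    show "so2_Psi \<iota> k K \<in> carrier (so2_HKV k)" if "K \<in> carrier (so2_H k)" for K
      using that surj by blast
    show "so2_Psi \<iota> k (K \<otimes>\<^bsub>so2_H k\<^esub> L) =
        so2_Psi \<iota> k K \<otimes>\<^bsub>so2_HKV k\<^esub> so2_Psi \<iota> k L"
      if "K \<in> carrier (so2_H k)" "L \<in> carrier (so2_H k)" for K L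
      using that linear_add[OF assms(1)]
      by (auto simp: carrier_so2_H mult_so2_H mult_so2_HKV so2_Psi_singleton comp_def)
  qed
  moreover have "so2_Psi \<iota> k (coset_scale (lie_coboundaries so2_bracket k) c K) =
      coset_scale (kv_coboundaries so2_mult so2_mult so2_mult k) c (so2_Psi \<iota> k K)"
    if "K \<in> carrier (so2_H k)" for c K
    using that linear_scale[OF assms(1)]
    by (auto simp: carrier_so2_H coset_scale_singleton lie_coboundaries_so2
        kv_coboundaries_so2 so2_Psi_singleton comp_def)
  ultimately show ?thesis
    by (simp add: so2_linear_iso_def iso_def bij_betw_def)
qed

end

theory Submission
  imports Defs
begin

text \<open>The cokernel of a surjective homomorphism is trivial, and \<open>\<Psi>\<^sup>k\<close>, being an isomorphism,
  is surjective: \<open>Q\<^sup>k\<close> is the quotient of \<open>H\<^sup>k\<^sub>K\<^sub>V\<close> by all of itself. Its only element is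
  then the coset \<open>H\<^sup>k\<^sub>K\<^sub>V\<close>, provided that \<open>H\<^sup>k\<^sub>K\<^sub>V\<close> is a group; this takes a little work, since
  quotients of groups are groups only for normal subgroups. On \<open>so2\<close> the product vanishes,
  so every cochain is a cocycle and \<open>0\<close> is the only coboundary: \<open>H\<^sup>k\<^sub>K\<^sub>V\<close> is the quotient of
  the additive group of cochains by its trivial subgroup.\<close>

lemma comm_group_fun_group:
  fixes Z :: "('b \<Rightarrow> 'w::real_vector) set"
  assumes zero: "(\<lambda>x. 0) \<in> Z"
    and add: "\<And>f g. f \<in> Z \<Longrightarrow> g \<in> Z \<Longrightarrow> (\<lambda>x. f x + g x) \<in> Z"
    and uminus: "\<And>f. f \<in> Z \<Longrightarrow> (\<lambda>x. - f x) \<in> Z"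
  shows "comm_group (fun_group Z)"
proof (rule comm_groupI)
  show "\<exists>g\<in>carrier (fun_group Z). g \<otimes>\<^bsub>fun_group Z\<^esub> f = \<one>\<^bsub>fun_group Z\<^esub>"
    if "f \<in> carrier (fun_group Z)" for f
    using that uminus by (intro bexI[of _ "\<lambda>x. - f x"]) (auto simp: fun_group_def)
qed (use zero add in \<open>auto simp: fun_group_def add.assoc add.commute\<close>)

lemma multilinear_of_degree_add:
  assumes "multilinear_of_degree q f" "multilinear_of_degree q g"
  shows "multilinear_of_degree q (\<lambda>xs. f xs + g xs)"
  using assms by (auto simp: multilinear_of_degree_def intro: linear_compose_add)

lemma multilinear_of_degree_uminus:
  assumes "multilinear_of_degree q f"
  shows "multilinear_of_degree q (\<lambda>xs. - f xs)"
  using assms by (auto simp: multilinear_of_degree_def intro: linear_compose_neg)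

text \<open>All associators on \<open>so2\<close> vanish, so \<open>J(W)\<close> is all of \<open>so2\<close> and degree \<open>0\<close> is no
  exception.\<close>

lemma kv_cochains_so2: "kv_cochains so2_mult so2_mult q = {f. multilinear_of_degree q f}"
  by (simp add: kv_cochains_def kv_J_def so2_mult_eq_0)

lemma group_so2_HKV: "group (so2_HKV q)"
proof -
  let ?C = "fun_group (kv_cocycles so2_mult so2_mult so2_mult q)"
  have "comm_group ?C"
    using zero_in_kv_cochains_so2[of q]
    by (intro comm_group_fun_group)
      (auto simp: kv_cocycles_so2 kv_cochains_so2
        intro: multilinear_of_degree_add multilinear_of_degree_uminus)
  then have "group ?C"
    by (rule comm_group.axioms)
  then have "{\<one>\<^bsub>?C\<^esub>} \<lhd> ?C"
    by (rule group.one_is_normal)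
  moreover have "{\<one>\<^bsub>?C\<^esub>} = kv_coboundaries so2_mult so2_mult so2_mult q"
    by (simp add: kv_coboundaries_so2 fun_group_def)
  ultimately show ?thesis
    unfolding kv_cohomology_def by (metis normal.factorgroup_is_group)
qed

lemma (in group) trivial_group_Mod_carrier: "trivial_group (G Mod carrier G)"
proof -
  have "carrier G \<lhd> G"
    by (simp add: normal_inv_iff subgroup_self)
  moreover have "carrier (G Mod carrier G) = {carrier G}"
    by (auto simp: FactGroup_def RCOSETS_def coset_join2 subgroup_self)
  ultimately show ?thesis
    by (simp add: trivial_group_def normal.factorgroup_is_group)
qed

lemma trivial_group_so2_Q:
  assumes "so2_linear_iso k (so2_Psi \<iota> k)"
  shows "trivial_group (so2_Q \<iota> k)"
proof -
  have "so2_Psi \<iota> k ` carrier (so2_H k) = carrier (so2_HKV k)"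
    using assms by (simp add: so2_linear_iso_def iso_def bij_betw_def)
  then show ?thesis
    using group.trivial_group_Mod_carrier[OF group_so2_HKV] by (simp add: so2_Q_def)
qed

theorem theorem29:
  fixes \<iota> :: "real \<Rightarrow> so2"
  assumes "linear \<iota>" and "inj \<iota>"
    and "so2_linear_iso 0 (so2_Psi \<iota> 0)"
    and "so2_linear_iso 1 (so2_Psi \<iota> 1)"
  shows "trivial_group (so2_Q \<iota> 0) \<and> trivial_group (so2_Q \<iota> 1)"
  using assms(3,4) by (simp add: trivial_group_so2_Q)

end
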